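(* Let $\Gamma$ and $\Gamma'$ be finite simple graphs with at least three vertices, let $f:V(\Gamma)\to V(\Gamma')$ be a bijection, and for each $v\in V(\Gamma)$ let $\phi_v:\Gamma-v\to\Gamma'-f(v)$ be a graph isomorphism. Let $\widetilde{\Gamma}$ be the associated directed graph of $(\Gamma,\Gamma',f,\{\phi_v\}_{v\in V(\Gamma)})$. If for some positive integer $k$ and some sequence $v_1,\ldots,v_{2k}\in V(\widetilde{\Gamma})$ (not necessarily distinct) there exist arrows $v_{2i-1}\longrightarrow v_{2i}$ and $v_{2i}\dashrightarrow v_{2i+1}$ in $\widetilde{\Gamma}$ for all $i=1,\ldots,k$ (where $v_{2k+1}:=v_1$), and if the cycle $v_1,\ldots,v_{2k}$ is $\alpha$-type, then there exist normal-arrows $v_1\longrightarrow v_2$ and $v_2\longrightarrow v_1$ in $\widetilde{\Gamma}$.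
   Context: $\Gamma-v$ denotes the full (induced) subgraph of $\Gamma$ on $V(\Gamma)\setminus\{v\}$; $E(\Gamma)$ is the edge set and $[u,w]$ denotes an edge joining $u$ and $w$. The associated directed graph $\widetilde{\Gamma}=\widetilde{\Gamma}(\Gamma,\Gamma',f,\{\phi_v\}_{v\in V(\Gamma)})$ has vertex set $V(\widetilde{\Gamma})=V(\Gamma)$ and two kinds of arrows. There is a normal-arrow from $v_1$ to $v_2$, written $v_1\longrightarrow v_2$, if and only if $v_2\ne v_1$, $[v_1,v_2]\notin E(\Gamma)$ and $[f(v_1),\phi_{v_1}(v_2)]\in E(\Gamma')$. There is a dashed-arrow from $v_1$ to $v_2$, written $v_1\dashrightarrow v_2$, if and only if $v_2\neq v_1$, $[f(v_1),f(v_2)]\notin E(\Gamma')$ and $[v_1,\phi_{v_1}^{-1}(f(v_2))]\in E(\Gamma)$. (The condition $v_2\ne v_1$ is needed for $\phi_{v_1}(v_2)$ and $\phi_{v_1}^{-1}(f(v_2))$ to be defined.) $\alpha$-type and $\beta$-type. Let $v_1,\ldots,v_{2k}$ be a cycle as in the claim, read the indices modulo $2k$, and put $v'_j:=f(v_j)$. Regard each $\phi_{v_j}$ as a partial map from $V(\Gamma)$ to $V(\Gamma')$, undefined exactly at $v_j$, and $\phi_{v_j}^{-1}$ as a partial map from $V(\Gamma')$ to $V(\Gamma)$, undefined exactly at $v'_j$. For $t=0,1,\ldots,k-1$ define sequences (whose terms may be undefined, i.e. "blank") $({b'}^{(2t)}_i)_{i\ge1}$ in $V(\Gamma')$ and $(b^{(2t+1)}_i)_{i\ge1}$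 in $V(\Gamma)$ by $${b'}^{(2t)}_1=v'_{2t+1},\quad {b'}^{(2t)}_2=\phi_{v_{2t+1}}(v_{2t+2}),\quad {b'}^{(2t)}_3=\phi_{v_{2t+1}}\circ\phi_{v_{2t+2}}^{-1}(v'_{2t+3}),\quad {b'}^{(2t)}_4=\phi_{v_{2t+1}}\circ\phi_{v_{2t+2}}^{-1}\circ\phi_{v_{2t+3}}(v_{2t+4}),\ \ldots$$ $$b^{(2t+1)}_1=v_{2t+2},\quad b^{(2t+1)}_2=\phi_{v_{2t+2}}^{-1}(v'_{2t+3}),\quad b^{(2t+1)}_3=\phi_{v_{2t+2}}^{-1}\circ\phi_{v_{2t+3}}(v_{2t+4}),\ \ldots$$ In general, with $\psi_j:=\phi_{v_j}$ and $x_j:=v'_j$ for $j$ odd, and $\psi_j:=\phi_{v_j}^{-1}$ and $x_j:=v_j$ for $j$ even, the $i$-th term of the sequence with superscript $(s)$ is $\psi_{s+1}\circ\psi_{s+2}\circ\cdots\circ\psi_{s+i-1}(x_{s+i})$; it is blank if at some stage a partial map is applied at a point where it is undefined. The cycle $v_1,\ldots,v_{2k}$ is $\alpha$-type if there is a positive integer $n_0$ such that for every $t=0,1,\ldots,k-1$: ${b'}^{(2t)}_i$ and $b^{(2t+1)}_i$ are not blank for all $1\le i\le n_0$; ${b'}^{(2t)}_i$ and $b^{(2t+1)}_i$ are blank for all $i\ge n_0+1$; and ${b'}^{(2t)}_{n_0}=v'_{2t}$ and $b^{(2t+1)}_{n_0}=v_{2t+1}$ (where $v'_0:=v'_{2k}$).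 Otherwise it is $\beta$-type. *)

theory Defs
  imports "Graph_Theory.Graph_Theory"
begin

text \<open>
  Finite simple graphs are instances of \<^locale>\<open>pair_graph\<close>: an edge $[u,w]$ is represented by the
  two arcs \<open>(u, w)\<close> and \<open>(w, u)\<close> in \<^const>\<open>parcs\<close>.
\<close>

definition graph_isomorphism ::
    "('a, 'c) pre_digraph \<Rightarrow> ('b, 'd) pre_digraph \<Rightarrow> ('a \<Rightarrow> 'b) \<Rightarrow> bool" where
  "graph_isomorphism H H' g \<longleftrightarrow>
     bij_betw g (verts H) (verts H') \<and>
     (\<forall>u \<in> verts H. \<forall>w \<in> verts H. u \<rightarrow>\<^bsub>H\<^esub> w \<longleftrightarrow> g u \<rightarrow>\<^bsub>H'\<^esub> g w)"

text \<open>For graphs without parallel arcs this is the vertex part of a library isomorphism.\<close>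

lemma graph_isomorphism_iff_app_iso:
  assumes "nomulti_digraph H" "nomulti_digraph H'"
  shows "graph_isomorphism H H' g \<longleftrightarrow>
    (\<exists>h. pre_digraph.digraph_isomorphism H h \<and> iso_verts h = g \<and> app_iso h H = H')"
proof
  interpret H: nomulti_digraph H by fact
  interpret H': nomulti_digraph H' by fact
  {
    assume iso: "graph_isomorphism H H' g"
    then have inj: "inj_on g (verts H)" and img: "g ` verts H = verts H'"
      by (auto simp: graph_isomorphism_def bij_betw_def)
    have "\<forall>a \<in> arcs H. \<exists>a' \<in> arcs H'. tail H' a' = g (tail H a) \<and> head H' a' = g (head H a)"
    proof
      fix a assume a: "a \<in> arcs H"
      then have "tail H a \<rightarrow>\<^bsub>H\<^esub> head H a" by (rule H.in_arcs_imp_in_arcs_ends)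
      with a iso have "g (tail H a) \<rightarrow>\<^bsub>H'\<^esub> g (head H a)"
        by (auto simp: graph_isomorphism_def)
      then show "\<exists>a' \<in> arcs H'. tail H' a' = g (tail H a) \<and> head H' a' = g (head H a)"
        by (auto simp: arcs_ends_def arc_to_ends_def)
    qed
    then obtain F where F: "\<And>a. a \<in> arcs H \<Longrightarrow> F a \<in> arcs H' \<and>
        tail H' (F a) = g (tail H a) \<and> head H' (F a) = g (head H a)"
      by metis
    let ?h = "\<lparr>iso_verts = g, iso_arcs = F, iso_head = head H', iso_tail = tail H'\<rparr>"
    have "inj_on F (arcs H)"
    proof (rule inj_onI)
      fix a b assume ab: "a \<in> arcs H" "b \<in> arcs H" "F a = F b"
      then have "g (tail H a) = g (tail H b)" "g (head H a) = g (head H b)"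
        using F by metis+
      with ab inj have "tail H a = tail H b" "head H a = head H b"
        by (auto dest: inj_onD)
      with ab show "a = b" by (auto intro: H.no_multi_arcs simp: arc_to_ends_def)
    qed
    moreover have "F ` arcs H = arcs H'"
    proof (intro equalityI subsetI)
      fix a' assume a': "a' \<in> arcs H'"
      then have "tail H' a' \<in> verts H'" "head H' a' \<in> verts H'" by auto
      with img obtain u w where uw: "u \<in> verts H" "w \<in> verts H" "tail H' a' = g u" "head H' a' = g w"
        by (metis imageE)
      have "tail H' a' \<rightarrow>\<^bsub>H'\<^esub> head H' a'" using a' by (rule H'.in_arcs_imp_in_arcs_ends)
      with uw iso have "u \<rightarrow>\<^bsub>H\<^esub> w" by (auto simp: graph_isomorphism_def)
      then obtain a where a: "a \<in> arcs H" "tail H a = u" "head H a = w"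
        by (auto simp: arcs_ends_def arc_to_ends_def)
      then have "F a = a'"
        using F[of a] a' uw by (auto intro!: H'.no_multi_arcs simp: arc_to_ends_def)
      with a show "a' \<in> F ` arcs H" by blast
    qed (use F in auto)
    ultimately have "H.digraph_isomorphism ?h \<and> iso_verts ?h = g \<and> app_iso ?h H = H'"
      using F inj img H.wf_digraph unfolding H.digraph_isomorphism_def
      by (auto simp: app_iso_def)
    then show "\<exists>h. H.digraph_isomorphism h \<and> iso_verts h = g \<and> app_iso h H = H'" by blast
  }
  assume "\<exists>h. H.digraph_isomorphism h \<and> iso_verts h = g \<and> app_iso h H = H'"
  then obtain h where h: "H.digraph_isomorphism h" and g: "iso_verts h = g" and H': "app_iso h H = H'"
    by blast
  have inj: "inj_on g (verts H)" using h g by (simp add: H.digraph_isomorphism_def)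
  have ends: "arcs_ends H' = (\<lambda>(u, w). (g u, g w)) ` arcs_ends H"
    using h unfolding H'[symmetric] g[symmetric]
    by (force simp: arcs_ends_def arc_to_ends_def image_image H.iso_verts_tail H.iso_verts_head
      intro!: image_cong)
  have "u \<rightarrow>\<^bsub>H\<^esub> w" if "u \<in> verts H" "w \<in> verts H" "g u \<rightarrow>\<^bsub>H'\<^esub> g w" for u w
  proof -
    from that(3) obtain x y where xy: "x \<rightarrow>\<^bsub>H\<^esub> y" "g x = g u" "g y = g w"
      unfolding ends by auto
    then have "x \<in> verts H" "y \<in> verts H" by (auto dest: H.adj_in_verts)
    with xy inj that show ?thesis by (metis inj_onD)
  qed
  moreover have "g u \<rightarrow>\<^bsub>H'\<^esub> g w" if "u \<rightarrow>\<^bsub>H\<^esub> w" for u w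
    unfolding ends using that by force
  moreover have "g ` verts H = verts H'" using g H' by (auto simp: app_iso_def)
  ultimately show "graph_isomorphism H H' g"
    using inj unfolding graph_isomorphism_def bij_betw_def by blast
qed

definition vertex_deleted :: "'a pair_pre_digraph \<Rightarrow> 'a \<Rightarrow> ('a, 'a \<times> 'a) pre_digraph" where
  "vertex_deleted G v = with_proj G \<restriction> (pverts G - {v})"

text \<open>
  A family \<open>\<phi>\<close> of maps \<open>\<phi> v\<close> from $\Gamma - v$ to $\Gamma' - f(v)$ is given by total functions of which
  only the values on \<open>pverts G - {v}\<close> matter; hence the inverse of \<open>\<phi> v\<close> is taken relative to that
  set.
\<close>

definition phi_inv :: "'a pair_pre_digraph \<Rightarrow> ('a \<Rightarrow> 'a \<Rightarrow> 'b) \<Rightarrow> 'a \<Rightarrow> 'b \<Rightarrow> 'a" where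
  "phi_inv G \<phi> v = inv_into (pverts G - {v}) (\<phi> v)"

record 'a two_arrow_digraph =
  vertices :: "'a set"
  normal_arrows :: "'a rel"
  dashed_arrows :: "'a rel"

definition associated_digraph ::
    "'a pair_pre_digraph \<Rightarrow> 'b pair_pre_digraph \<Rightarrow> ('a \<Rightarrow> 'b) \<Rightarrow> ('a \<Rightarrow> 'a \<Rightarrow> 'b)
      \<Rightarrow> 'a two_arrow_digraph" where
  "associated_digraph G G' f \<phi> =
     \<lparr> vertices = pverts G,
       normal_arrows = {(v1, v2) \<in> pverts G \<times> pverts G.
         v2 \<noteq> v1 \<and> (v1, v2) \<notin> parcs G \<and> (f v1, \<phi> v1 v2) \<in> parcs G'},
       dashed_arrows = {(v1, v2) \<in> pverts G \<times> pverts G.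
         v2 \<noteq> v1 \<and> (f v1, f v2) \<notin> parcs G' \<and> (v1, phi_inv G \<phi> v1 (f v2)) \<in> parcs G} \<rparr>"

text \<open>The same maps as partial maps, undefined exactly at \<open>v\<close> and at \<open>f v\<close>, respectively.\<close>

definition phi_partial ::
    "'a pair_pre_digraph \<Rightarrow> ('a \<Rightarrow> 'a \<Rightarrow> 'b) \<Rightarrow> 'a \<Rightarrow> 'a \<rightharpoonup> 'b" where
  "phi_partial G \<phi> v x = (if x \<in> pverts G - {v} then Some (\<phi> v x) else None)"

definition phi_inv_partial ::
    "'a pair_pre_digraph \<Rightarrow> 'b pair_pre_digraph \<Rightarrow> ('a \<Rightarrow> 'b) \<Rightarrow> ('a \<Rightarrow> 'a \<Rightarrow> 'b)
      \<Rightarrow> 'a \<Rightarrow> 'b \<rightharpoonup> 'a" where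
  "phi_inv_partial G G' f \<phi> v y =
     (if y \<in> pverts G' - {f v} then Some (phi_inv G \<phi> v y) else None)"

text \<open>
  A sequence $v_1,\ldots,v_{2k}$ is a function on \<^typ>\<open>nat\<close> of which only the values at \<open>1, \<dots>, 2 * k\<close>
  matter; \<open>cyc_seq k v\<close> reads its indices modulo \<open>2 * k\<close>, so that index \<open>0\<close> stands for \<open>2 * k\<close> and
  index \<open>2 * k + 1\<close> for \<open>1\<close>.
\<close>

definition cyc_seq :: "nat \<Rightarrow> (nat \<Rightarrow> 'a) \<Rightarrow> nat \<Rightarrow> 'a" where
  "cyc_seq k v j = v (if j mod (2 * k) = 0 then 2 * k else j mod (2 * k))"

text \<open>
  With $\psi_j = \phi_{v_j}$, $x_j = f(v_j)$ for odd $j$ and $\psi_j = \phi_{v_j}^{-1}$, $x_j = v_j$ for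
  even $j$, the $i$-th term of the sequence with superscript $(s)$ is
  $\psi_{s+1}\circ\cdots\circ\psi_{s+i-1}(x_{s+i})$. Its first term is $x_{s+1}$, and its term $i+1$ is
  $\psi_{s+1}$ applied to the $i$-th term of the sequence with superscript $(s+1)$; this is the
  recursion below. The terms lie in \<open>pverts G'\<close> for even \<open>s\<close> (\<open>b_seq'\<close>) and in \<open>pverts G\<close> for odd \<open>s\<close>
  (\<open>b_seq\<close>); each function is meaningful only for superscripts of its own parity. \<^const>\<open>None\<close> means
  blank. The sequences start at \<open>i = 1\<close>, and the value at \<open>i = 0\<close> is a dummy. The argument \<open>w\<close> is the
  cycle with its indices already read modulo its length.
\<close>

fun b_seq' ::
    "'a pair_pre_digraph \<Rightarrow> 'b pair_pre_digraph \<Rightarrow> ('a \<Rightarrow> 'b) \<Rightarrow> ('a \<Rightarrow> 'a \<Rightarrow> 'b) \<Rightarrow> (nat \<Rightarrow> 'a)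
      \<Rightarrow> nat \<Rightarrow> nat \<Rightarrow> 'b option"
  and b_seq ::
    "'a pair_pre_digraph \<Rightarrow> 'b pair_pre_digraph \<Rightarrow> ('a \<Rightarrow> 'b) \<Rightarrow> ('a \<Rightarrow> 'a \<Rightarrow> 'b) \<Rightarrow> (nat \<Rightarrow> 'a)
      \<Rightarrow> nat \<Rightarrow> nat \<Rightarrow> 'a option" where
  "b_seq' G G' f \<phi> w s 0 = None"
| "b_seq' G G' f \<phi> w s (Suc 0) = Some (f (w (s + 1)))"
| "b_seq' G G' f \<phi> w s (Suc (Suc i)) =
     Option.bind (b_seq G G' f \<phi> w (s + 1) (Suc i)) (phi_partial G \<phi> (w (s + 1)))"
| "b_seq G G' f \<phi> w s 0 = None"
| "b_seq G G' f \<phi> w s (Suc 0) = Some (w (s + 1))"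
| "b_seq G G' f \<phi> w s (Suc (Suc i)) =
     Option.bind (b_seq' G G' f \<phi> w (s + 1) (Suc i)) (phi_inv_partial G G' f \<phi> (w (s + 1)))"

definition alpha_type ::
    "'a pair_pre_digraph \<Rightarrow> 'b pair_pre_digraph \<Rightarrow> ('a \<Rightarrow> 'b) \<Rightarrow> ('a \<Rightarrow> 'a \<Rightarrow> 'b)
      \<Rightarrow> nat \<Rightarrow> (nat \<Rightarrow> 'a) \<Rightarrow> bool" where
  "alpha_type G G' f \<phi> k v \<longleftrightarrow>
     (let w = cyc_seq k v;
          b' = b_seq' G G' f \<phi> w;
          b = b_seq G G' f \<phi> w
      in \<exists>n0 \<ge> 1. \<forall>t < k.
           (\<forall>i. 1 \<le> i \<and> i \<le> n0 \<longrightarrow> b' (2 * t) i \<noteq> None \<and> b (2 * t + 1) i \<noteq> None) \<and>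
           (\<forall>i \<ge> n0 + 1. b' (2 * t) i = None \<and> b (2 * t + 1) i = None) \<and>
           b' (2 * t) n0 = Some (f (w (2 * t))) \<and>
           b (2 * t + 1) n0 = Some (w (2 * t + 1)))"

end

theory Submission
  imports Defs
begin

text \<open>
  Every consecutive pair of terms of one of the sequences is the image, under a composition of the
  graph isomorphisms, of the first two terms of a later sequence, and these are adjacent because of
  the arrows of the cycle. For an $\alpha$-type cycle the last two terms of the sequence with
  superscript $(2)$ are $\phi_{v_2}(v_1)$ and $f(v_2)$, so these are adjacent; this is the missing
  condition for $v_2 \longrightarrow v_1$.
\<close>

lemma pair_graph_arcs_symmetric:
  assumes "pair_graph G" "(x, y) \<in> parcs G"
  shows "(y, x) \<in> parcs G"
proof -
  interpret pair_graph G by fact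
  show ?thesis using assms(2) by (rule arcs_symmetric)
qed

lemma vertex_deleted_simps:
  "verts (vertex_deleted G v) = pverts G - {v}"
  "x \<rightarrow>\<^bsub>vertex_deleted G v\<^esub> y \<longleftrightarrow> x \<in> pverts G - {v} \<and> y \<in> pverts G - {v} \<and> (x, y) \<in> parcs G"
  by (auto simp: vertex_deleted_def arcs_ends_def arc_to_ends_def)

text \<open>In an induced subgraph adjacency agrees with that of the whole graph as soon as both
  endpoints survive, and the bijection keeps images away from \<open>u'\<close>. Later steps can
  therefore work with \<open>parcs\<close> directly.\<close>

lemma vertex_deleted_isomorphismD:
  assumes "graph_isomorphism (vertex_deleted G u) (vertex_deleted G' u') g"
  shows "bij_betw g (pverts G - {u}) (pverts G' - {u'})"
    and "\<And>x y. \<lbrakk>x \<in> pverts G - {u}; y \<in> pverts G - {u}\<rbrakk>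
      \<Longrightarrow> (g x, g y) \<in> parcs G' \<longleftrightarrow> (x, y) \<in> parcs G"
proof -
  show bij: "bij_betw g (pverts G - {u}) (pverts G' - {u'})"
    using assms by (simp add: graph_isomorphism_def vertex_deleted_simps)
  fix x y assume xy: "x \<in> pverts G - {u}" "y \<in> pverts G - {u}"
  then have "g x \<in> pverts G' - {u'}" "g y \<in> pverts G' - {u'}"
    using bij by (blast dest: bij_betwE)+
  with xy show "(g x, g y) \<in> parcs G' \<longleftrightarrow> (x, y) \<in> parcs G"
    using assms by (auto simp: graph_isomorphism_def vertex_deleted_simps)
qed

text \<open>Applying the edge equivalence for \<open>\<phi> u\<close> to the two preimages gives
  this, since \<open>\<phi> u\<close> undoes \<open>phi_inv\<close> on its range.\<close>

lemma phi_inv_arc_iff: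
  assumes iso: "graph_isomorphism (vertex_deleted G u) (vertex_deleted G' u') (\<phi> u)"
    and "x \<in> pverts G' - {u'}" "y \<in> pverts G' - {u'}"
  shows "(phi_inv G \<phi> u x, phi_inv G \<phi> u y) \<in> parcs G \<longleftrightarrow> (x, y) \<in> parcs G'"
proof -
  note bij = vertex_deleted_isomorphismD(1)[OF iso]
  have inv: "phi_inv G \<phi> u z \<in> pverts G - {u} \<and> \<phi> u (phi_inv G \<phi> u z) = z"
    if "z \<in> pverts G' - {u'}" for z
    using bij_betwE[OF bij_betw_inv_into[OF bij]] bij_betw_inv_into_right[OF bij that] that
    unfolding phi_inv_def by blast
  show ?thesis
    using vertex_deleted_isomorphismD(2)[OF iso, of "phi_inv G \<phi> u x" "phi_inv G \<phi> u y"]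
      inv[OF assms(2)] inv[OF assms(3)] by simp
qed

text \<open>Each recursion step raises the superscript by one and so flips its parity; hence both
  claims are proved by one induction on \<open>i\<close>, with \<open>s\<close> arbitrary.\<close>

lemma b_seq_consecutive_adjacent:
  assumes iso: "\<And>j. graph_isomorphism (vertex_deleted G (w j)) (vertex_deleted G' (f (w j))) (\<phi> (w j))"
    and odd_arrow: "\<And>j. odd j \<Longrightarrow> (f (w j), \<phi> (w j) (w (Suc j))) \<in> parcs G'"
    and even_arrow: "\<And>j. \<lbrakk>even j; j > 0\<rbrakk> \<Longrightarrow> (w j, phi_inv G \<phi> (w j) (f (w (Suc j)))) \<in> parcs G"
  shows "\<lbrakk>even s; b_seq' G G' f \<phi> w s i = Some a'; b_seq' G G' f \<phi> w s (Suc i) = Some c'\<rbrakk>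
      \<Longrightarrow> (a', c') \<in> parcs G'"
    and "\<lbrakk>odd s; b_seq G G' f \<phi> w s i = Some a; b_seq G G' f \<phi> w s (Suc i) = Some c\<rbrakk>
      \<Longrightarrow> (a, c) \<in> parcs G"
proof (induction i arbitrary: s a a' c c')
  case 0
  \<comment> \<open>Index 0 carries the dummy \<open>None\<close>, so the premises fail.\<close>
  { case 1 then show ?case by simp next case 2 then show ?case by simp }
next
  case (Suc i)
  { case 1
    show ?case
    proof (cases i)
      case 0
      \<comment> \<open>The first two terms are \<open>f (w (Suc s))\<close> and
        \<open>\<phi> (w (Suc s)) (w (Suc (Suc s)))\<close>; since \<open>Suc s\<close> is odd,
        their edge is that of a normal-arrow.\<close>
      with 1 odd_arrow[of "Suc s"] show ?thesis
        by (auto simp: phi_partial_def split: if_splits)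
    next
      case (Suc l)
      \<comment> \<open>Both terms are images under the same map \<open>\<phi> (w (Suc s))\<close>,
        and being non-blank puts their arguments in its domain, so the isomorphism carries over the
        edge given by induction.\<close>
      with 1 obtain a c where
        "b_seq G G' f \<phi> w (Suc s) i = Some a" "b_seq G G' f \<phi> w (Suc s) (Suc i) = Some c"
        "a \<in> pverts G - {w (Suc s)}" "c \<in> pverts G - {w (Suc s)}"
        "a' = \<phi> (w (Suc s)) a" "c' = \<phi> (w (Suc s)) c"
        by (auto simp: phi_partial_def bind_eq_Some_conv simp del: b_seq.simps split: if_splits)
      with 1 Suc.IH(2)[of "Suc s" a c] vertex_deleted_isomorphismD(2)[OF iso, of a "Suc s" c]
      show ?thesis by simp
    qed
  next
    case 2
    show ?case
    proof (cases i)
      case 0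
      with 2 even_arrow[of "Suc s"] show ?thesis
        by (auto simp: phi_inv_partial_def split: if_splits)
    next
      case (Suc l)
      with 2 obtain a' c' where
        "b_seq' G G' f \<phi> w (Suc s) i = Some a'" "b_seq' G G' f \<phi> w (Suc s) (Suc i) = Some c'"
        "a' \<in> pverts G' - {f (w (Suc s))}" "c' \<in> pverts G' - {f (w (Suc s))}"
        "a = phi_inv G \<phi> (w (Suc s)) a'" "c = phi_inv G \<phi> (w (Suc s)) c'"
        by (auto simp: phi_inv_partial_def bind_eq_Some_conv simp del: b_seq'.simps split: if_splits)
      with 2 Suc.IH(1)[of "Suc s" a' c'] phi_inv_arc_iff[where \<phi> = \<phi>, OF iso, of a' "Suc s" c']
      show ?thesis by simp
    qed
  }
qed

text \<open>The recursion uses \<open>s\<close> only to read \<open>w\<close> at positions beyond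
  \<open>s\<close>, so a period of \<open>w\<close> is a period in the superscript.\<close>

lemma b_seq_periodic:
  assumes "\<And>j. w (j + p) = w j"
  shows "b_seq' G G' f \<phi> w (s + p) i = b_seq' G G' f \<phi> w s i"
    and "b_seq G G' f \<phi> w (s + p) i = b_seq G G' f \<phi> w s i"
proof (induction i arbitrary: s)
  case (Suc i)
  have w: "w (Suc (s + p)) = w (Suc s)" for s using assms[of "Suc s"] by simp
  { case 1 then show ?case using Suc.IH(2)[of "Suc s"] w by (cases i) auto
  next case 2 then show ?case using Suc.IH(1)[of "Suc s"] w by (cases i) auto }
qed simp_all

lemma cyc_seq_periodic: "cyc_seq k v (j + 2 * k) = cyc_seq k v j"
  by (simp add: cyc_seq_def)

lemma cyc_seq_eq:
  assumes "i \<in> {1..2 * k}"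
  shows "cyc_seq k v i = v i"
  using assms by (cases "i = 2 * k") (auto simp: cyc_seq_def)

lemma cyc_seq_cong:
  assumes "i mod (2 * k) = j mod (2 * k)"
  shows "cyc_seq k v i = cyc_seq k v j"
  using assms by (simp only: cyc_seq_def)

theorem proposition4p2:
  fixes G :: "'a pair_pre_digraph" and G' :: "'b pair_pre_digraph"
    and f :: "'a \<Rightarrow> 'b" and \<phi> :: "'a \<Rightarrow> 'a \<Rightarrow> 'b"
    and k :: nat and v :: "nat \<Rightarrow> 'a"
  assumes "pair_graph G" and "pair_graph G'"
    and "card (pverts G) \<ge> 3" and "card (pverts G') \<ge> 3"
    and "bij_betw f (pverts G) (pverts G')"
    and "\<And>u. u \<in> pverts G \<Longrightarrow>
      graph_isomorphism (vertex_deleted G u) (vertex_deleted G' (f u)) (\<phi> u)"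
    and "k \<ge> 1"
    and "\<And>i. i \<in> {1..2 * k} \<Longrightarrow> v i \<in> vertices (associated_digraph G G' f \<phi>)"
    and "\<And>i. i \<in> {1..k} \<Longrightarrow>
      (v (2 * i - 1), v (2 * i)) \<in> normal_arrows (associated_digraph G G' f \<phi>)"
    and "\<And>i. i \<in> {1..k} \<Longrightarrow>
      (v (2 * i), cyc_seq k v (2 * i + 1)) \<in> dashed_arrows (associated_digraph G G' f \<phi>)"
    and "alpha_type G G' f \<phi> k v"
  shows "(v 1, v 2) \<in> normal_arrows (associated_digraph G G' f \<phi>) \<and>
         (v 2, v 1) \<in> normal_arrows (associated_digraph G G' f \<phi>)"
proof -
  note iso = assms(6) and k = assms(7) and vert = assms(8) and normal = assms(9)
    and dashed = assms(10) and alpha = assms(11)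
  define w where "w = cyc_seq k v"
  define b' where "b' = b_seq' G G' f \<phi> w"
  define b where "b = b_seq G G' f \<phi> w"

  \<comment> \<open>Parity survives reduction because the modulus \<open>2 * k\<close> is even; the
    residue 0 is represented by \<open>2 * k\<close>.\<close>
  have rep: "\<exists>i \<in> {1..2 * k}. i mod (2 * k) = j mod (2 * k) \<and> (even i \<longleftrightarrow> even j)" for j
  proof (cases "j mod (2 * k) = 0")
    case True
    with k show ?thesis by (intro bexI[of _ "2 * k"]) auto
  next
    case False
    have "j mod (2 * k) < 2 * k" using k by simp
    then have "j mod (2 * k) \<in> {1..2 * k}" using False by (auto simp del: mod_less_divisor)
    moreover have "even (j mod (2 * k)) \<longleftrightarrow> even j" by (simp add: dvd_mod_iff)
    ultimately show ?thesis by (intro bexI[of _ "j mod (2 * k)"]) auto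
  qed
  have w_eq: "w i = v i" if "i \<in> {1..2 * k}" for i
    using that unfolding w_def by (rule cyc_seq_eq)
  have w_cong: "w i = w j" "w (Suc i) = w (Suc j)" if "i mod (2 * k) = j mod (2 * k)" for i j
  proof -
    have "Suc i mod (2 * k) = Suc j mod (2 * k)" using that by (metis mod_Suc_eq)
    with that show "w i = w j" "w (Suc i) = w (Suc j)" unfolding w_def by (auto intro: cyc_seq_cong)
  qed
  have w_vert: "w j \<in> pverts G" for j
  proof -
    obtain i where i: "i \<in> {1..2 * k}" "i mod (2 * k) = j mod (2 * k)" using rep by blast
    then have "w j = v i" using w_cong w_eq by metis
    with vert[OF i(1)] show ?thesis by (simp add: associated_digraph_def)
  qed
  have odd_arrow: "(f (w j), \<phi> (w j) (w (Suc j))) \<in> parcs G'" if "odd j" for j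
  proof -
    obtain i where i: "i \<in> {1..2 * k}" "i mod (2 * k) = j mod (2 * k)" "odd i"
      using rep[of j] \<open>odd j\<close> by auto
    \<comment> \<open>For odd \<open>i\<close> one has \<open>i = 2 * (i div 2) + 1\<close>, which
      explains the witness \<open>Suc (i div 2)\<close>.\<close>
    then obtain m where m: "i = 2 * m - 1" "m \<in> {1..k}"
      by (auto elim!: oddE intro!: that[of "Suc (i div 2)"])
    with i have "Suc i = 2 * m" "Suc i \<in> {1..2 * k}" by auto
    with normal[OF m(2)] m(1) i have "(w j, w (Suc j)) \<in> normal_arrows (associated_digraph G G' f \<phi>)"
      using w_cong[OF i(2)] w_eq[of i] w_eq[of "Suc i"] by simp
    then show ?thesis by (simp add: associated_digraph_def)
  qed
  have even_arrow: "(w j, phi_inv G \<phi> (w j) (f (w (Suc j)))) \<in> parcs G" if "even j" for j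
  proof -
    obtain i where i: "i \<in> {1..2 * k}" "i mod (2 * k) = j mod (2 * k)" "even i"
      using rep[of j] \<open>even j\<close> by auto
    then obtain m where m: "i = 2 * m" "m \<in> {1..k}" by (auto elim!: evenE)
    \<comment> \<open>The head stays in the form \<open>cyc_seq\<close>: for
      \<open>i = 2 * k\<close> its index leaves the range of \<open>w_eq\<close> and wraps around to
      1.\<close>
    with dashed[OF m(2)] i have "(w j, w (Suc j)) \<in> dashed_arrows (associated_digraph G G' f \<phi>)"
      using w_cong[OF i(2)] w_eq[of i] by (simp add: w_def)
    then show ?thesis by (simp add: associated_digraph_def)
  qed

  obtain n where n: "n \<ge> 1"
    and last: "\<And>t. t < k \<Longrightarrow> b' (2 * t) n = Some (f (w (2 * t))) \<and> b (2 * t + 1) n = Some (w (2 * t + 1))"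
    using alpha unfolding alpha_type_def Let_def w_def[symmetric] b'_def[symmetric] b_def[symmetric]
    by blast
  have w12: "w 1 = v 1" "w 2 = v 2" using k by (simp_all add: w_def cyc_seq_eq)
  have arrow: "(v 1, v 2) \<in> normal_arrows (associated_digraph G G' f \<phi>)" using normal[of 1] k by simp
  have last_b: "b 1 n = Some (v 1)" using last[of 0] k w12 by simp
  have last_b': "b' 2 n = Some (f (v 2))"
  proof (cases "k = 1")
    case True
    \<comment> \<open>For \<open>k = 1\<close> the only even superscript covered by
      \<open>alpha\<close> is 0, and superscript 2 is its shift by one period.\<close>
    have "b' (0 + 2 * k) n = b' 0 n" "w (0 + 2 * k) = w 0"
      unfolding b'_def w_def by (intro b_seq_periodic cyc_seq_periodic)+
    with last[of 0] True w12 show ?thesis by (simp add: numeral_2_eq_2)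
  next
    case False
    with last[of 1] k w12 show ?thesis by simp
  qed
  \<comment> \<open>A length of 1 would give \<open>v 2 = v 1\<close>, contrary to the normal-arrow;
    so the last terms have predecessors.\<close>
  obtain m where m: "n = Suc (Suc m)"
  proof (cases "n = 1")
    case True
    with last_b w12 have "v 2 = v 1" by (simp add: b_def numeral_2_eq_2)
    with arrow show ?thesis by (simp add: associated_digraph_def)
  next
    case False
    with n that[of "n - 2"] show ?thesis by simp
  qed
  \<comment> \<open>Unfolding the last term \<open>v 1\<close> of \<open>b 1\<close> once yields
    \<open>y\<close>, the penultimate term of \<open>b' 2\<close>.\<close>
  obtain y where y: "b' 2 (Suc m) = Some y" "y \<in> pverts G' - {f (v 2)}" "v 1 = phi_inv G \<phi> (v 2) y"
    using last_b w12 unfolding m b_def b'_def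
    by (auto simp: bind_eq_Some_conv phi_inv_partial_def numeral_2_eq_2 split: if_splits)
  have "(y, f (v 2)) \<in> parcs G'"
    using b_seq_consecutive_adjacent(1)[of G w G' f \<phi> 2 "Suc m" y "f (v 2)"]
      iso w_vert odd_arrow even_arrow y(1) last_b' unfolding b'_def m by simp
  then have adj: "(f (v 2), y) \<in> parcs G'"
    using pair_graph_arcs_symmetric[OF assms(2)] by blast
  have "bij_betw (\<phi> (v 2)) (pverts G - {v 2}) (pverts G' - {f (v 2)})"
    using vertex_deleted_isomorphismD(1)[OF iso] w_vert[of 2] w12 by simp
  then have "\<phi> (v 2) (v 1) = y"
    using y(2,3) by (simp add: phi_inv_def bij_betw_inv_into_right)
  \<comment> \<open>Distinctness and non-adjacency of \<open>v 2\<close> and \<open>v 1\<close> are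
    inherited from the first arrow by symmetry.\<close>
  with adj arrow show ?thesis
    using pair_graph_arcs_symmetric[OF assms(1)] by (auto simp: associated_digraph_def)
qed

end
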